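(* Let a group $\Gamma$ act as isometries on proper metric spaces $X_1,X_2,X_3$, and for each $j=1,2,3$ let $\Pi_j$ be an abstract pattern space over $(X_j,\Gamma)$. Suppose a subshift $\Sigma$ of $\Pi_3$ satisfies: for each $\mathcal{P}_1\in\Pi_1$ there is $\mathcal{P}_1'\in\Sigma$ such that $\mathcal{P}_1$ and $\mathcal{P}_1'$ are mutually locally derivable, and for each $\mathcal{P}_2\in\Pi_2$ there is $\mathcal{P}_2'\in\Sigma$ such that $\mathcal{P}_2$ and $\mathcal{P}_2'$ are mutually locally derivable. Then for each $\mathcal{P}_1\in\Pi_1$ and $\mathcal{P}_2\in\Pi_2$, $\mathcal{P}_1$ and $\mathcal{P}_2$ are mutually locally derivable if and only if $\Sigma_{\mathcal{P}_1}=\Sigma_{\mathcal{P}_2}$, where $\Sigma_{\mathcal{P}}=\{\mathcal{Q}\in\Sigma\mid\mathcal{Q}\text{ is locally derivable from }\mathcal{P}\}$.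
   Context: $B(x,r)$ denotes the closed ball; proper means all closed balls are compact; $\mathrm{Cl}(X)$ is the set of closed subsets of $X$; the metric spaces are non-empty. Abstract pattern space over $(X,\Gamma)$ ($\Gamma$ acting on $X$ by homeomorphisms): a non-empty set $\Pi$ with a map $\Pi\times\mathrm{Cl}(X)\to\Pi$, $(\mathcal{P},C)\mapsto\mathcal{P}\wedge C$ and an action of $\Gamma$ on $\Pi$ such that (1) $(\mathcal{P}\wedge C_1)\wedge C_2=\mathcal{P}\wedge(C_1\cap C_2)$; (2) for each $\mathcal{P}$ there is a (unique) closed set $\operatorname{supp}\mathcal{P}$ with $\mathcal{P}\wedge C=\mathcal{P}\iff C\supset\operatorname{supp}\mathcal{P}$ for all closed $C$; (3) $(\gamma\mathcal{P})\wedge(\gamma C)=\gamma(\mathcal{P}\wedge C)$. A subshift is a non-empty $\Gamma$-invariant subset. Local derivability: for abstract patterns $\mathcal{P}_1,\mathcal{P}_2$ in abstract pattern spaces over $(X,\Gamma)$, $(Y,\Gamma)$, $\mathcal{P}_2$ is locally derivable from $\mathcal{P}_1$ if there are $x_0\in X$, $y_0\in Y$, $R_0\geqq0$ such that for all $\gamma,\eta\in\Gamma$, $R\geqq0$: $(\gamma\mathcal{P}_1)\wedge B(x_0,R+R_0)=(\eta\mathcal{P}_1)\wedge B(x_0,R+R_0)$ implies $(\gamma\mathcal{P}_2)\wedge B(y_0,R)=(\eta\mathcal{P}_2)\wedge B(y_0,R)$. Mutually locally derivable: each is locally derivable from the other. *)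

theory Defs
  imports "HOL-Analysis.Analysis" "HOL-Algebra.Group_Action"
begin

definition proper_metric :: "'x metric \<Rightarrow> bool" where
  "proper_metric m \<longleftrightarrow>
     (\<forall>x \<in> mspace m. \<forall>r. compactin (mtopology_of m) (mcball_of m x r))"

definition isometric_action :: "('g, 'c) monoid_scheme \<Rightarrow> 'x metric \<Rightarrow> ('g \<Rightarrow> 'x \<Rightarrow> 'x) \<Rightarrow> bool" where
  "isometric_action G m \<phi> \<longleftrightarrow> group_action G (mspace m) \<phi> \<and>
     (\<forall>g \<in> carrier G. \<forall>x \<in> mspace m. \<forall>y \<in> mspace m. mdist m (\<phi> g x) (\<phi> g y) = mdist m x y)"

text \<open>
  In the following record, \<open>cut S P C\<close> stands for \<open>P \<and> C\<close> (the restriction of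
  the abstract pattern \<open>P\<close> to the closed set \<open>C\<close>) and \<open>pact S\<close> is the action of
  the group on the patterns.  As usual in HOL-Algebra, both are meaningful only
  on the carriers: \<open>P \<in> patterns S\<close>, \<open>C\<close> closed, and group elements.
\<close>

record ('g, 'x, 'p) pattern_structure =
  patterns :: "'p set"
  cut :: "'p \<Rightarrow> 'x set \<Rightarrow> 'p"
  pact :: "'g \<Rightarrow> 'p \<Rightarrow> 'p"

locale abstract_pattern_space =
  space: group_action G "topspace X" \<phi> + pattern: group_action G "patterns S" "pact S"
  for G :: "('g, 'c) monoid_scheme" (structure)
    and X :: "'x topology"
    and \<phi> :: "'g \<Rightarrow> 'x \<Rightarrow> 'x"
    and S :: "('g, 'x, 'p) pattern_structure" +
  assumes homeo: "g \<in> carrier G \<Longrightarrow> homeomorphic_map X X (\<phi> g)"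
    and nonempty: "patterns S \<noteq> {}"
    and cut_closed: "\<lbrakk>P \<in> patterns S; closedin X C\<rbrakk> \<Longrightarrow> cut S P C \<in> patterns S"
    and cut_cut: "\<lbrakk>P \<in> patterns S; closedin X C; closedin X D\<rbrakk>
      \<Longrightarrow> cut S (cut S P C) D = cut S P (C \<inter> D)"
    and ex1_supp: "P \<in> patterns S
      \<Longrightarrow> \<exists>!K. closedin X K \<and> (\<forall>C. closedin X C \<longrightarrow> (cut S P C = P \<longleftrightarrow> K \<subseteq> C))"
    and cut_equivariant: "\<lbrakk>g \<in> carrier G; P \<in> patterns S; closedin X C\<rbrakk>
      \<Longrightarrow> cut S (pact S g P) (\<phi> g ` C) = pact S g (cut S P C)"

definition subshift ::
  "('g, 'c) monoid_scheme \<Rightarrow> ('g, 'x, 'p) pattern_structure \<Rightarrow> 'p set \<Rightarrow> bool" where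
  "subshift G S \<Sigma> \<longleftrightarrow> \<Sigma> \<noteq> {} \<and> \<Sigma> \<subseteq> patterns S \<and> (\<forall>g \<in> carrier G. pact S g ` \<Sigma> \<subseteq> \<Sigma>)"

text \<open>
  \<open>locally_derivable G m1 S1 P1 m2 S2 P2\<close> means that \<open>P2\<close> is locally derivable
  \<^emph>\<open>from\<close> \<open>P1\<close>.
\<close>

definition locally_derivable ::
  "('g, 'c) monoid_scheme
    \<Rightarrow> 'x metric \<Rightarrow> ('g, 'x, 'p) pattern_structure \<Rightarrow> 'p
    \<Rightarrow> 'y metric \<Rightarrow> ('g, 'y, 'q) pattern_structure \<Rightarrow> 'q \<Rightarrow> bool" where
  "locally_derivable G m1 S1 P1 m2 S2 P2 \<longleftrightarrow>
     (\<exists>x0 \<in> mspace m1. \<exists>y0 \<in> mspace m2. \<exists>R0 \<ge> 0.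
        \<forall>g \<in> carrier G. \<forall>h \<in> carrier G. \<forall>R \<ge> 0.
          cut S1 (pact S1 g P1) (mcball_of m1 x0 (R + R0)) =
          cut S1 (pact S1 h P1) (mcball_of m1 x0 (R + R0)) \<longrightarrow>
          cut S2 (pact S2 g P2) (mcball_of m2 y0 R) =
          cut S2 (pact S2 h P2) (mcball_of m2 y0 R))"

definition mutually_locally_derivable ::
  "('g, 'c) monoid_scheme
    \<Rightarrow> 'x metric \<Rightarrow> ('g, 'x, 'p) pattern_structure \<Rightarrow> 'p
    \<Rightarrow> 'y metric \<Rightarrow> ('g, 'y, 'q) pattern_structure \<Rightarrow> 'q \<Rightarrow> bool" where
  "mutually_locally_derivable G m1 S1 P1 m2 S2 P2 \<longleftrightarrow>
     locally_derivable G m1 S1 P1 m2 S2 P2 \<and> locally_derivable G m2 S2 P2 m1 S1 P1"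

text \<open>The set \<open>\<Sigma>\<^sub>P\<close> of elements of \<open>\<Sigma> \<subseteq> patterns S'\<close> locally derivable from \<open>P\<close>:\<close>

definition derivable_elements ::
  "('g, 'c) monoid_scheme
    \<Rightarrow> 'y metric \<Rightarrow> ('g, 'y, 'q) pattern_structure \<Rightarrow> 'q set
    \<Rightarrow> 'x metric \<Rightarrow> ('g, 'x, 'p) pattern_structure \<Rightarrow> 'p \<Rightarrow> 'q set" where
  "derivable_elements G m' S' \<Sigma> m S P = {Q \<in> \<Sigma>. locally_derivable G m S P m' S' Q}"

end

theory Submission
  imports Defs
begin

text \<open>
  Everything rests on local derivability being transitive.  Write \<open>P \<rightarrow> Q\<close> if
  \<open>Q\<close> is locally derivable from \<open>P\<close>.  This bounds how far one must look at \<open>P\<close>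
  to know \<open>Q\<close> on a ball, so derivations \<open>P \<rightarrow> Q \<rightarrow> Q'\<close> compose by adding their
  constants.  The one obstacle is that they may look at \<open>Q\<close> around different
  base points \<open>y\<close> and \<open>y'\<close>; this costs the additional constant \<open>d(y, y')\<close>,
  because agreement of patterns on a ball restricts to every smaller ball.

  Given transitivity, \<open>P \<rightarrow> Q\<close> always implies
  \<open>\<Sigma>\<^bsub>Q\<^esub> \<subseteq> \<Sigma>\<^bsub>P\<^esub>\<close>.  The converse holds as soon as \<open>Q\<close> has a representative
  \<open>Q' \<in> \<Sigma>\<close> up to mutual local derivability: then \<open>Q' \<in> \<Sigma>\<^bsub>Q\<^esub> \<subseteq> \<Sigma>\<^bsub>P\<^esub>\<close>, and
  \<open>P \<rightarrow> Q' \<rightarrow> Q\<close>.  Hence derivability among the patterns considered is the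
  reverse inclusion of the sets \<open>\<Sigma>\<^bsub>P\<^esub>\<close>, and mutual derivability is equality.
\<close>

lemma (in abstract_pattern_space) cut_eq_subset:
  assumes "P \<in> patterns S" "Q \<in> patterns S" "closedin X C" "closedin X D" "D \<subseteq> C"
    and "cut S P C = cut S Q C"
  shows "cut S P D = cut S Q D"
proof -
  have "cut S P D = cut S (cut S P C) D"
    using assms cut_cut[of P C D] by (simp add: Int_absorb1)
  also have "\<dots> = cut S Q D"
    using assms cut_cut[of Q C D] by (simp add: Int_absorb1)
  finally show ?thesis .
qed

lemma mcball_of_subset_shift:
  assumes "x \<in> mspace m" "y \<in> mspace m"
  shows "mcball_of m y r \<subseteq> mcball_of m x (r + mdist m x y)"
  using assms mdist_triangle[of x m y] by (fastforce simp: mcball_of_def Metric_space.mcball_def)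

text \<open>
  A ball of radius \<open>R + R\<^sub>1\<close> about the base point \<open>y'\<close> of the second derivation
  lies in the ball of radius \<open>R + R\<^sub>1 + d(y, y')\<close> about the base point \<open>y\<close> of the
  first, so \<open>R\<^sub>1 + d(y, y') + R\<^sub>0\<close> is a constant for the composite.
\<close>

lemma locally_derivable_trans:
  assumes "abstract_pattern_space G (mtopology_of m2) \<phi> S2" and "P2 \<in> patterns S2"
    and "locally_derivable G m1 S1 P1 m2 S2 P2"
    and "locally_derivable G m2 S2 P2 m3 S3 P3"
  shows "locally_derivable G m1 S1 P1 m3 S3 P3"
proof -
  interpret abstract_pattern_space G "mtopology_of m2" \<phi> S2 by fact
  obtain x y R0 where x: "x \<in> mspace m1" and y: "y \<in> mspace m2" and "R0 \<ge> 0"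
    and P2: "\<And>g h R. \<lbrakk>g \<in> carrier G; h \<in> carrier G; R \<ge> 0;
        cut S1 (pact S1 g P1) (mcball_of m1 x (R + R0)) =
        cut S1 (pact S1 h P1) (mcball_of m1 x (R + R0))\<rbrakk> \<Longrightarrow>
        cut S2 (pact S2 g P2) (mcball_of m2 y R) = cut S2 (pact S2 h P2) (mcball_of m2 y R)"
    using assms(3) unfolding locally_derivable_def by blast
  obtain y' z R1 where y': "y' \<in> mspace m2" and z: "z \<in> mspace m3" and "R1 \<ge> 0"
    and P3: "\<And>g h R. \<lbrakk>g \<in> carrier G; h \<in> carrier G; R \<ge> 0;
        cut S2 (pact S2 g P2) (mcball_of m2 y' (R + R1)) =
        cut S2 (pact S2 h P2) (mcball_of m2 y' (R + R1))\<rbrakk> \<Longrightarrow>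
        cut S3 (pact S3 g P3) (mcball_of m3 z R) = cut S3 (pact S3 h P3) (mcball_of m3 z R)"
    using assms(4) unfolding locally_derivable_def by blast
  define d where "d = mdist m2 y y'"
  have "d \<ge> 0" by (simp add: d_def)
  have "cut S3 (pact S3 g P3) (mcball_of m3 z R) = cut S3 (pact S3 h P3) (mcball_of m3 z R)"
    if g: "g \<in> carrier G" and h: "h \<in> carrier G" and "R \<ge> 0"
      and eq: "cut S1 (pact S1 g P1) (mcball_of m1 x (R + (R1 + d + R0))) =
        cut S1 (pact S1 h P1) (mcball_of m1 x (R + (R1 + d + R0)))" for g h R
  proof (rule P3[OF g h \<open>R \<ge> 0\<close>], rule cut_eq_subset)
    show "pact S2 g P2 \<in> patterns S2" "pact S2 h P2 \<in> patterns S2"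
      using g h \<open>P2 \<in> patterns S2\<close> pattern.element_image by blast+
    show "mcball_of m2 y' (R + R1) \<subseteq> mcball_of m2 y (R + R1 + d)"
      unfolding d_def by (rule mcball_of_subset_shift[OF y y'])
    show "cut S2 (pact S2 g P2) (mcball_of m2 y (R + R1 + d)) =
        cut S2 (pact S2 h P2) (mcball_of m2 y (R + R1 + d))"
      using eq \<open>R \<ge> 0\<close> \<open>R1 \<ge> 0\<close> \<open>d \<ge> 0\<close> by (intro P2 g h) (simp_all add: add.assoc)
  qed (simp_all add: mcball_of_def mtopology_of_def Metric_space.closedin_mcball)
  moreover have "R1 + d + R0 \<ge> 0"
    using \<open>R0 \<ge> 0\<close> \<open>R1 \<ge> 0\<close> \<open>d \<ge> 0\<close> by simp
  ultimately show ?thesis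
    using x z unfolding locally_derivable_def by blast
qed

text \<open>
  The representative of \<open>P2\<close> in \<open>\<Sigma>\<close> is derivable from \<open>P2\<close>, so the inclusion makes
  it derivable from \<open>P1\<close> as well; and \<open>P2\<close> can be recovered from it.
\<close>

lemma locally_derivable_iff_derivable_elements_subset:
  assumes "abstract_pattern_space G (mtopology_of m2) \<phi>2 S2" and "P2 \<in> patterns S2"
    and "abstract_pattern_space G (mtopology_of m3) \<phi>3 S3" and "\<Sigma> \<subseteq> patterns S3"
    and "\<exists>Q \<in> \<Sigma>. mutually_locally_derivable G m2 S2 P2 m3 S3 Q"
  shows "locally_derivable G m1 S1 P1 m2 S2 P2 \<longleftrightarrow>
    derivable_elements G m3 S3 \<Sigma> m2 S2 P2 \<subseteq> derivable_elements G m3 S3 \<Sigma> m1 S1 P1"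
proof
  assume "locally_derivable G m1 S1 P1 m2 S2 P2"
  then show "derivable_elements G m3 S3 \<Sigma> m2 S2 P2 \<subseteq> derivable_elements G m3 S3 \<Sigma> m1 S1 P1"
    using locally_derivable_trans[OF assms(1,2), of m1 S1 P1 m3 S3]
    unfolding derivable_elements_def by blast
next
  assume sub: "derivable_elements G m3 S3 \<Sigma> m2 S2 P2 \<subseteq> derivable_elements G m3 S3 \<Sigma> m1 S1 P1"
  obtain Q where "Q \<in> \<Sigma>" and to_Q: "locally_derivable G m2 S2 P2 m3 S3 Q"
    and from_Q: "locally_derivable G m3 S3 Q m2 S2 P2"
    using assms(5) unfolding mutually_locally_derivable_def by blast
  have "Q \<in> patterns S3"
    using \<open>Q \<in> \<Sigma>\<close> assms(4) by blast
  moreover have "locally_derivable G m1 S1 P1 m3 S3 Q"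
    using sub \<open>Q \<in> \<Sigma>\<close> to_Q unfolding derivable_elements_def by blast
  ultimately show "locally_derivable G m1 S1 P1 m2 S2 P2"
    using from_Q by (rule locally_derivable_trans[OF assms(3)])
qed

theorem lemma5p2:
  fixes \<Gamma> :: "('g, 'c) monoid_scheme"
    and X\<^sub>1 :: "'x1 metric" and X\<^sub>2 :: "'x2 metric" and X\<^sub>3 :: "'x3 metric"
    and \<phi>\<^sub>1 :: "'g \<Rightarrow> 'x1 \<Rightarrow> 'x1" and \<phi>\<^sub>2 :: "'g \<Rightarrow> 'x2 \<Rightarrow> 'x2" and \<phi>\<^sub>3 :: "'g \<Rightarrow> 'x3 \<Rightarrow> 'x3"
    and \<Pi>\<^sub>1 :: "('g, 'x1, 'p1) pattern_structure"
    and \<Pi>\<^sub>2 :: "('g, 'x2, 'p2) pattern_structure"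
    and \<Pi>\<^sub>3 :: "('g, 'x3, 'p3) pattern_structure"
    and \<Sigma> :: "'p3 set"
  assumes "group \<Gamma>"
    and "mspace X\<^sub>1 \<noteq> {}" and "mspace X\<^sub>2 \<noteq> {}" and "mspace X\<^sub>3 \<noteq> {}"
    and "proper_metric X\<^sub>1" and "proper_metric X\<^sub>2" and "proper_metric X\<^sub>3"
    and "isometric_action \<Gamma> X\<^sub>1 \<phi>\<^sub>1"
    and "isometric_action \<Gamma> X\<^sub>2 \<phi>\<^sub>2"
    and "isometric_action \<Gamma> X\<^sub>3 \<phi>\<^sub>3"
    and "abstract_pattern_space \<Gamma> (mtopology_of X\<^sub>1) \<phi>\<^sub>1 \<Pi>\<^sub>1"
    and "abstract_pattern_space \<Gamma> (mtopology_of X\<^sub>2) \<phi>\<^sub>2 \<Pi>\<^sub>2"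
    and "abstract_pattern_space \<Gamma> (mtopology_of X\<^sub>3) \<phi>\<^sub>3 \<Pi>\<^sub>3"
    and "subshift \<Gamma> \<Pi>\<^sub>3 \<Sigma>"
    and "\<forall>P\<^sub>1 \<in> patterns \<Pi>\<^sub>1. \<exists>P\<^sub>1' \<in> \<Sigma>. mutually_locally_derivable \<Gamma> X\<^sub>1 \<Pi>\<^sub>1 P\<^sub>1 X\<^sub>3 \<Pi>\<^sub>3 P\<^sub>1'"
    and "\<forall>P\<^sub>2 \<in> patterns \<Pi>\<^sub>2. \<exists>P\<^sub>2' \<in> \<Sigma>. mutually_locally_derivable \<Gamma> X\<^sub>2 \<Pi>\<^sub>2 P\<^sub>2 X\<^sub>3 \<Pi>\<^sub>3 P\<^sub>2'"
  shows "\<forall>P\<^sub>1 \<in> patterns \<Pi>\<^sub>1. \<forall>P\<^sub>2 \<in> patterns \<Pi>\<^sub>2.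
    mutually_locally_derivable \<Gamma> X\<^sub>1 \<Pi>\<^sub>1 P\<^sub>1 X\<^sub>2 \<Pi>\<^sub>2 P\<^sub>2 \<longleftrightarrow>
    derivable_elements \<Gamma> X\<^sub>3 \<Pi>\<^sub>3 \<Sigma> X\<^sub>1 \<Pi>\<^sub>1 P\<^sub>1 = derivable_elements \<Gamma> X\<^sub>3 \<Pi>\<^sub>3 \<Sigma> X\<^sub>2 \<Pi>\<^sub>2 P\<^sub>2"
proof (intro ballI)
  fix P\<^sub>1 P\<^sub>2
  assume P: "P\<^sub>1 \<in> patterns \<Pi>\<^sub>1" "P\<^sub>2 \<in> patterns \<Pi>\<^sub>2"
  have \<Sigma>: "\<Sigma> \<subseteq> patterns \<Pi>\<^sub>3"
    using \<open>subshift \<Gamma> \<Pi>\<^sub>3 \<Sigma>\<close> unfolding subshift_def by blast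
  note from_1 = locally_derivable_iff_derivable_elements_subset[OF assms(12) P(2) assms(13) \<Sigma>
      bspec[OF assms(16) P(2)], of X\<^sub>1 \<Pi>\<^sub>1 P\<^sub>1]
  note from_2 = locally_derivable_iff_derivable_elements_subset[OF assms(11) P(1) assms(13) \<Sigma>
      bspec[OF assms(15) P(1)], of X\<^sub>2 \<Pi>\<^sub>2 P\<^sub>2]
  show "mutually_locally_derivable \<Gamma> X\<^sub>1 \<Pi>\<^sub>1 P\<^sub>1 X\<^sub>2 \<Pi>\<^sub>2 P\<^sub>2 \<longleftrightarrow>
    derivable_elements \<Gamma> X\<^sub>3 \<Pi>\<^sub>3 \<Sigma> X\<^sub>1 \<Pi>\<^sub>1 P\<^sub>1 = derivable_elements \<Gamma> X\<^sub>3 \<Pi>\<^sub>3 \<Sigma> X\<^sub>2 \<Pi>\<^sub>2 P\<^sub>2"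
    unfolding mutually_locally_derivable_def from_1 from_2 by blast
qed

end
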